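(* Let $r$ be a positive integer, $a,b$ coprime positive integers with $a\ge br$, $z$ a nonzero complex number, and $\bm x=(x_1,\dots,x_r)$, $\bm y=(y_1,\dots,y_r)$ with nonzero complex entries. Then \[ L_{a/b}(z^b\bm x;z^{-b}\bm y;q,z^a)=\frac1a\sum_{u\ (\mathrm{mod}\ a)}\frac{H_{a/b}(\zeta_a^u\bm x;\zeta_a^{-u}\bm y;q)}{\prod_{s=1}^r(z^bx_s;q)_\infty(qz^{-b}y_s;q)_\infty}\,\theta\!\left(-\zeta_a^{-u}zq^{\frac{1-a}{2ab}};q^{\frac1{ab}}\right), \] provided that each $H_{a/b}(\zeta_a^u\bm x;\zeta_a^{-u}\bm y;q)$ converges absolutely.
   Context: $q\in\mathbb{C}$, $0<|q|<1$; real powers $q^c$ are $e^{c\log q}$ for a fixed choice of $\log q$. $\zeta_a^k=e^{2\pi ik/a}$. For $a\in\mathbb{C}$, $(a;q)_\infty=\prod_{j\ge0}(1-aq^j)$ and for real $c$, $(a;q)_c:=(a;q)_\infty/(aq^c;q)_\infty$. $\theta(w;p):=\sum_{n\in\mathbb{Z}}(-w)^np^{\binom n2}=(w;p)_\infty(p/w;p)_\infty(p;p)_\infty$. For $c\in\mathbb{C}$ and a vector $\bm v$, $c\bm v$ is the componentwise product. For real $\alpha\ge r$ and $w\in\mathbb{C}$, \[ L_\alpha(\bm x;\bm y;q,w):=\sum_{n\in\mathbb{Z}}w^nq^{(\alpha-r)\binom n2}\prod_{s=1}^r\frac{(1/y_s;q)_n(-y_s)^n}{(x_s;q)_n}, \]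 and \[ H_\alpha(\bm x;\bm y;q):=\sum_{i_1,\dots,i_r,j_1,\dots,j_r\ge0}\frac{q^{\frac12Q_\alpha(\bm i,\bm j)}\prod_{s}(-x_s)^{i_s}(-y_s)^{j_s}}{\prod_s(q;q)_{i_s}(q;q)_{j_s}},\quad Q_\alpha(\bm i,\bm j)=\sum_{s}(i_s^2+j_s^2)-\frac1\alpha\Big(\sum_s(i_s-j_s)\Big)^2. \]
   Formalization: H is evaluated at (ζ_a^{bu}x; ζ_a^{-bu}y) instead of (ζ_a^u x; ζ_a^{-u}y), since the printed formula fails for b>1 (e.g. a=3, b=2, r=1); for b=1 they agree. The denominators (z^b x_s;q)_∞, (qz^{-b}y_s;q)_∞ are assumed nonzero. *)

theory Defs
  imports "HOL-Analysis.Analysis"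
begin

definition qpoch_inf :: "complex \<Rightarrow> complex \<Rightarrow> complex" where
  "qpoch_inf a q = (\<Prod>j. 1 - a * q ^ j)"

(* (a;q)_n for integer n. The quotient (a;q)_inf / (a q^n;q)_inf is 0/0 at a = q^(-m), 0 <= n <= m,
   a case that does occur for a = 1/y_s; the finite products below also give the right value there.
   Lemma qpoch_eq_quotient says that they agree with the quotient wherever it is defined. *)
definition qpoch :: "complex \<Rightarrow> complex \<Rightarrow> int \<Rightarrow> complex" where
  "qpoch a q n =
     (if 0 \<le> n then \<Prod>j<nat n. 1 - a * q ^ j
      else inverse (\<Prod>j=1..nat (- n). 1 - a / q ^ j))"

lemma convergent_prod_qpoch:
  fixes a q :: complex
  assumes "norm q < 1"
  shows "convergent_prod (\<lambda>j. 1 - a * q ^ j)"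
proof -
  have "summable (\<lambda>j. norm a * norm q ^ j)"
    using assms by (intro summable_mult summable_geometric) auto
  hence "summable (\<lambda>j. norm ((1 - a * q ^ j) - 1))"
    by (simp add: norm_mult norm_power)
  thus ?thesis
    by (intro abs_convergent_prod_imp_convergent_prod summable_imp_abs_convergent_prod)
qed

lemma qpoch_inf_shift:
  assumes "norm q < 1"
  shows "qpoch_inf a q = (\<Prod>j<n. 1 - a * q ^ j) * qpoch_inf (a * q ^ n) q"
proof -
  have conv: "convergent_prod (\<lambda>j. 1 - c * q ^ j)" for c
    by (rule convergent_prod_qpoch[OF assms])
  have "(\<lambda>N. \<Prod>j\<le>N. 1 - c * q ^ j) \<longlonglongrightarrow> qpoch_inf c q" for c
    unfolding qpoch_inf_def by (rule convergent_prod_LIMSEQ[OF conv])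
  hence lim: "(\<lambda>N. \<Prod>j<N. 1 - c * q ^ j) \<longlonglongrightarrow> qpoch_inf c q" for c
    by (simp add: LIMSEQ_lessThan_iff_atMost)
  have split: "(\<Prod>j<N + n. 1 - a * q ^ j) =
      (\<Prod>j<n. 1 - a * q ^ j) * (\<Prod>j<N. 1 - (a * q ^ n) * q ^ j)" for N
    by (induction N) (simp_all add: power_add algebra_simps)
  have "(\<lambda>N. \<Prod>j<N + n. 1 - a * q ^ j) \<longlonglongrightarrow> qpoch_inf a q"
    using lim by (rule LIMSEQ_ignore_initial_segment)
  moreover have "(\<lambda>N. \<Prod>j<N + n. 1 - a * q ^ j) \<longlonglongrightarrow>
      (\<Prod>j<n. 1 - a * q ^ j) * qpoch_inf (a * q ^ n) q"
    unfolding split by (intro tendsto_intros lim)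
  ultimately show ?thesis by (rule LIMSEQ_unique)
qed

lemma qpoch_eq_quotient:
  assumes "q \<noteq> 0" "norm q < 1" and nz: "qpoch_inf (a * q powi n) q \<noteq> 0"
  shows "qpoch a q n = qpoch_inf a q / qpoch_inf (a * q powi n) q"
proof (cases "0 \<le> n")
  case True
  thus ?thesis
    using qpoch_inf_shift[OF assms(2), of a "nat n"] nz
    by (simp add: qpoch_def power_int_def)
next
  case False
  define m where "m = nat (- n)"
  have n: "n = - int m" "m > 0" using False by (auto simp: m_def)
  have shift: "qpoch_inf (a / q ^ m) q = (\<Prod>j<m. 1 - a / q ^ m * q ^ j) * qpoch_inf a q"
    using qpoch_inf_shift[OF assms(2), of "a / q ^ m" m] assms(1) by simp
  have "(\<Prod>j<m. 1 - a / q ^ m * q ^ j) = (\<Prod>j=1..m. 1 - a / q ^ j)"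
  proof (rule prod.reindex_bij_witness[of _ "\<lambda>j. m - j" "\<lambda>j. m - j"])
    fix j assume "j \<in> {..<m}"
    hence "q ^ m = q ^ (m - j) * q ^ j" by (simp flip: power_add)
    thus "1 - a / q ^ (m - j) = 1 - a / q ^ m * q ^ j" using assms(1) by simp
  qed auto
  moreover have "a * q powi n = a / q ^ m"
    by (simp add: n power_int_minus divide_inverse)
  ultimately show ?thesis
    using shift nz False by (simp add: qpoch_def m_def[symmetric] field_simps)
qed

definition qtheta :: "complex \<Rightarrow> complex \<Rightarrow> complex" where
  "qtheta w p = (\<Sum>\<^sub>\<infinity>n\<in>(UNIV :: int set). (- w) powi n * p powi (n * (n - 1) div 2))"

(* Complex powers q^c with real c are exp (c * lq), lq being the chosen logarithm of q. *)
definition qpow :: "complex \<Rightarrow> real \<Rightarrow> complex" where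
  "qpow lq c = exp (of_real c * lq)"

definition zeta :: "nat \<Rightarrow> int \<Rightarrow> complex" where
  "zeta a k = exp (2 * of_real pi * \<i> * of_int k / of_nat a)"

(* In the series below r is CARD('r), and lq is the logarithm of q that fixes the real powers. *)
definition L_term ::
  "real \<Rightarrow> complex ^ 'r \<Rightarrow> complex ^ 'r \<Rightarrow> complex \<Rightarrow> complex \<Rightarrow> complex \<Rightarrow> int \<Rightarrow> complex" where
  "L_term \<alpha> x y q lq w n =
     w powi n * qpow lq ((\<alpha> - real CARD('r)) * of_int (n * (n - 1) div 2)) *
     (\<Prod>s\<in>UNIV. qpoch (1 / y $ s) q n * (- (y $ s)) powi n / qpoch (x $ s) q n)"

definition L_series ::
  "real \<Rightarrow> complex ^ 'r \<Rightarrow> complex ^ 'r \<Rightarrow> complex \<Rightarrow> complex \<Rightarrow> complex \<Rightarrow> complex" where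
  "L_series \<alpha> x y q lq w = (\<Sum>\<^sub>\<infinity>n\<in>UNIV. L_term \<alpha> x y q lq w n)"

definition Q_form :: "real \<Rightarrow> nat ^ 'r \<Rightarrow> nat ^ 'r \<Rightarrow> real" where
  "Q_form \<alpha> i j =
     (\<Sum>s\<in>UNIV. real (i $ s) ^ 2 + real (j $ s) ^ 2) -
     1 / \<alpha> * (\<Sum>s\<in>UNIV. real (i $ s) - real (j $ s)) ^ 2"

definition H_term ::
  "real \<Rightarrow> complex ^ 'r \<Rightarrow> complex ^ 'r \<Rightarrow> complex \<Rightarrow> complex \<Rightarrow> (nat ^ 'r) \<times> (nat ^ 'r) \<Rightarrow> complex" where
  "H_term \<alpha> x y q lq = (\<lambda>(i, j).
     qpow lq (Q_form \<alpha> i j / 2) *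
     (\<Prod>s\<in>UNIV. (- (x $ s)) ^ (i $ s) * (- (y $ s)) ^ (j $ s)) /
     (\<Prod>s\<in>UNIV. qpoch q q (int (i $ s)) * qpoch q q (int (j $ s))))"

definition H_series ::
  "real \<Rightarrow> complex ^ 'r \<Rightarrow> complex ^ 'r \<Rightarrow> complex \<Rightarrow> complex \<Rightarrow> complex" where
  "H_series \<alpha> x y q lq = (\<Sum>\<^sub>\<infinity>ij\<in>UNIV. H_term \<alpha> x y q lq ij)"

(* Exponent of the root of unity in H: the expansion of the left-hand side pairs
   z^N, N = a n + b k, with the terms of H for which k = sum_s (i_s - j_s). Hence N = b k (mod a),
   and the average over u mod a must combine H(zeta^(b u) x; zeta^(-b u) y) with
   theta(-zeta^(-u) z ...). The formula with H(zeta^u x; zeta^(-u) y) instead selects N = k (mod a)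
   and is false unless b = 1 (mod a); for b = 1 the two are the same. *)

end

theory Submission
  imports Defs
begin

text \<open>
  Multiplied by \<open>\<Prod>\<^sub>s (z\<^sup>b x\<^sub>s; q)\<^sub>\<infinity> (q z\<^sup>-\<^sup>b y\<^sub>s; q)\<^sub>\<infinity>\<close>, the \<open>n\<close>-th term of the bilateral series
  becomes a monomial times \<open>\<Prod>\<^sub>s (z\<^sup>b x\<^sub>s q\<^sup>n; q)\<^sub>\<infinity> (z\<^sup>-\<^sup>b y\<^sub>s q\<^sup>1\<^sup>-\<^sup>n; q)\<^sub>\<infinity>\<close>. Expanding these
  products by Euler's identity and completing the square in the exponent of \<open>q\<close> turns it into the
  sum over \<open>(i, j)\<close> of the \<open>(i, j)\<close>-th term of \<open>H\<close> times the \<open>N\<close>-th term of the theta series, where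
  \<open>N = a n + b k\<close> and \<open>k = \<Sum>\<^sub>s (i\<^sub>s - j\<^sub>s)\<close>. Summing over \<open>n\<close> gives all pairs of such terms with
  \<open>N \<equiv> b k (mod a)\<close>, and this congruence is what the average over the \<open>a\<close>-th roots of unity selects
  from the product of the two absolutely convergent series.
\<close>

section \<open>Shifted factorials at an integer index\<close>

text \<open>Stated for the reciprocal so that the quotient formula survives a vanishing shifted
  product: only (a;q)_inf has to be nonzero, which is what the theorem assumes. For n >= 0 the
  shifted product divides (a;q)_inf and cannot vanish; for n < 0 its vanishing makes both sides
  0.\<close>

lemma inverse_qpoch:
  assumes "q \<noteq> 0" "norm q < 1" and nz: "qpoch_inf a q \<noteq> 0"
  shows "inverse (qpoch a q n) = qpoch_inf (a * q powi n) q / qpoch_inf a q"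
proof (cases "qpoch_inf (a * q powi n) q = 0")
  case False
  thus ?thesis
    using qpoch_eq_quotient[OF assms(1,2) False] by simp
next
  case True
  show ?thesis
  proof (cases "0 \<le> n")
    case n: True
    have "qpoch_inf a q = qpoch a q n * qpoch_inf (a * q powi n) q"
      using qpoch_inf_shift[OF assms(2), of a "nat n"] n
      by (simp add: qpoch_def power_int_def)
    with True nz show ?thesis by simp
  next
    case n: False
    define m where "m = nat (- n)"
    have m: "n = - int m" using n by (auto simp: m_def)
    have "qpoch_inf (a / q ^ m) q = (\<Prod>j<m. 1 - a / q ^ m * q ^ j) * qpoch_inf a q"
      using qpoch_inf_shift[OF assms(2), of "a / q ^ m" m] assms(1) by simp
    moreover have "a * q powi n = a / q ^ m"
      by (simp add: m power_int_minus divide_inverse)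
    ultimately have "(\<Prod>j<m. 1 - a / q ^ m * q ^ j) = 0"
      using True nz by simp
    \<comment> \<open>The vanishing factor is, after cancelling \<open>q ^ j\<close>, one of the
      factors in the definition of \<open>qpoch\<close> at a negative index.\<close>
    then obtain j where j: "j < m" "1 - a / q ^ m * q ^ j = 0"
      by auto
    have "q ^ m = q ^ (m - j) * q ^ j" using j by (simp flip: power_add)
    hence "1 - a / q ^ (m - j) = 0" using j assms(1) by simp
    hence "(\<Prod>j=1..m. 1 - a / q ^ j) = 0"
      using j by (intro prod_zero bexI[of _ "m - j"]) auto
    \<comment> \<open>Here \<open>qpoch a q n\<close> is \<open>inverse 0 = 0\<close>, so its
      inverse is 0 as well and agrees with the right-hand side.\<close>
    thus ?thesis using True n by (simp add: qpoch_def m_def[symmetric])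
  qed
qed

lemma triangular_int_Suc: "(n + 1) * (n + 1 - 1) div 2 = n * (n - 1) div 2 + (n::int)"
proof -
  have "(n + 1) * (n + 1 - 1) = n * (n - 1) + n * 2" by (simp add: algebra_simps)
  thus ?thesis by simp
qed

lemma real_triangular_int: "real_of_int (n * (n - 1) div 2) = (of_int n ^ 2 - of_int n) / 2"
proof -
  have "even (n * (n - 1))" by simp
  hence "n * (n - 1) = 2 * (n * (n - 1) div 2)" by simp
  hence "real_of_int (n * (n - 1)) = 2 * real_of_int (n * (n - 1) div 2)"
    by (metis of_int_mult of_int_numeral)
  thus ?thesis by (simp add: power2_eq_square algebra_simps)
qed

lemma qpoch_of_nat: "qpoch a q (int m) = (\<Prod>j<m. 1 - a * q ^ j)"
  by (simp add: qpoch_def)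

lemma qpoch_neg_of_nat: "qpoch a q (- int m) = inverse (\<Prod>j=1..m. 1 - a / q ^ j)"
  by (cases "m = 0") (simp_all add: qpoch_def)

text \<open>Absorbing one -y into each factor turns 1 - q^m/y into q^m (1 - qy/q^(m+1)), and the
  powers q^m accumulate to the triangular exponent. The numerators of the bilateral series thereby
  become reciprocals to which \<open>inverse_qpoch\<close> applies, even when 1/y is a power of q.
  The two signs of n are separate inductions.\<close>

lemma qpoch_reflect:
  assumes "q \<noteq> 0" "y \<noteq> 0"
  shows "qpoch (1 / y) q n * (- y) powi n =
    q powi (n * (n - 1) div 2) * inverse (qpoch (q * y) q (- n))"
proof -
  have pos: "(\<Prod>j<m. 1 - 1 / y * q ^ j) * (- y) powi int m =
    q powi (int m * (int m - 1) div 2) * (\<Prod>j=1..m. 1 - q * y / q ^ j)" for m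
  proof (induction m)
    case 0 show ?case by simp
  next
    case (Suc m)
    have T: "int (Suc m) * (int (Suc m) - 1) div 2 = int m * (int m - 1) div 2 + int m"
      using triangular_int_Suc[of "int m"] by (simp add: algebra_simps)
    have "(\<Prod>j<Suc m. 1 - 1 / y * q ^ j) * (- y) powi int (Suc m) =
      ((\<Prod>j<m. 1 - 1 / y * q ^ j) * (- y) powi int m) * ((1 - 1 / y * q ^ m) * (- y))"
      by (simp only: power_int_of_nat power_Suc prod.lessThan_Suc mult_ac)
    also have "(1 - 1 / y * q ^ m) * (- y) = q ^ m * (1 - q * y / q ^ Suc m)"
      using assms by (simp add: field_simps)
    finally show ?case unfolding Suc.IH T using assms
      by (simp add: power_int_add)
  qed
  have neg: "(\<Prod>j=1..m. 1 - 1 / y / q ^ j) * (- y) ^ m =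
    inverse (q powi (- int m * (- int m - 1) div 2)) * (\<Prod>j<m. 1 - q * y * q ^ j)" for m
  proof (induction m)
    case 0 show ?case by simp
  next
    case (Suc m)
    have T: "- int m * (- int m - 1) div 2 = - int (Suc m) * (- int (Suc m) - 1) div 2 - int (Suc m)"
      using triangular_int_Suc[of "- int (Suc m)"] by (simp add: algebra_simps)
    have "(\<Prod>j=1..Suc m. 1 - 1 / y / q ^ j) * (- y) ^ Suc m =
      ((\<Prod>j=1..m. 1 - 1 / y / q ^ j) * (- y) ^ m) * ((1 - 1 / y / q ^ Suc m) * (- y))"
      by simp
    also have "(1 - 1 / y / q ^ Suc m) * (- y) = (1 - q * y * q ^ m) / q ^ Suc m"
      using assms by (simp add: field_simps)
    finally show ?case unfolding Suc.IH T using assms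
      by (simp add: power_int_diff power_int_add divide_inverse mult_ac)
  qed
  show ?thesis
  proof (cases n rule: int_cases2)
    case (nonneg m)
    thus ?thesis using pos[of m] by (simp only: qpoch_of_nat qpoch_neg_of_nat inverse_inverse_eq)
  next
    case (nonpos m)
    have "qpoch (1 / y) q n * (- y) powi n = inverse ((\<Prod>j=1..m. 1 - 1 / y / q ^ j) * (- y) ^ m)"
      unfolding nonpos qpoch_neg_of_nat by (simp add: power_int_minus)
    also have "\<dots> = q powi (n * (n - 1) div 2) * inverse (qpoch (q * y) q (- n))"
      unfolding neg by (simp add: nonpos qpoch_of_nat)
    finally show ?thesis .
  qed
qed

section \<open>Euler's expansion of the infinite product\<close>

text \<open>The coefficient of w^i in the power series of (w;q)_inf.\<close>

definition euler_coeff :: "complex \<Rightarrow> nat \<Rightarrow> complex" where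
  "euler_coeff q i = (- 1) ^ i * q powi (int i * (int i - 1) div 2) / qpoch q q (int i)"

lemma one_minus_power_neq_0: "norm (q::complex) < 1 \<Longrightarrow> 1 - q ^ Suc i \<noteq> 0"
proof
  assume "norm q < 1" "1 - q ^ Suc i = 0"
  hence "norm (q ^ Suc i) = 1" by (metis eq_iff_diff_eq_0 norm_one)
  moreover have "norm (q ^ Suc i) < 1"
    using \<open>norm q < 1\<close> by (simp only: norm_power power_Suc_less_one norm_ge_zero)
       (metis norm_ge_zero power_less_one_iff  zero_less_Suc)
  ultimately show False by simp
qed

text \<open>The coefficient form of the functional equation E(w) = (1 - w) E(qw). It serves both the
  ratio test and the proof of that equation.\<close>

lemma euler_coeff_Suc:
  assumes "q \<noteq> 0" "norm q < 1"
  shows "euler_coeff q (Suc i) * (1 - q ^ Suc i) = - (q ^ i * euler_coeff q i)"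
proof -
  have T: "int (Suc i) * (int (Suc i) - 1) div 2 = int i * (int i - 1) div 2 + int i"
    using triangular_int_Suc[of "int i"] by (simp add: algebra_simps)
  have "qpoch q q (int (Suc i)) = qpoch q q (int i) * (1 - q ^ Suc i)"
    by (simp add: qpoch_of_nat del: of_nat_Suc)
  thus ?thesis
    unfolding euler_coeff_def T using assms one_minus_power_neq_0[OF assms(2), of i]
    by (simp add: power_int_add)
qed

text \<open>By the recurrence, consecutive terms have ratio of modulus |q^i w / (1 - q^(i+1))|,
  which tends to 0; hence absolute convergence for every w.\<close>

lemma summable_euler:
  assumes "q \<noteq> 0" "norm q < 1"
  shows "summable (\<lambda>i. norm (euler_coeff q i * w ^ i))"
proof -
  have "(\<lambda>i. norm (q ^ i * w / (1 - q * q ^ i))) \<longlonglongrightarrow> norm (0 * w / (1 - q * 0))"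
    using assms by (intro tendsto_intros LIMSEQ_power_zero) auto
  hence "eventually (\<lambda>i. norm (q ^ i * w / (1 - q * q ^ i)) < 1 / 2) sequentially"
    by (rule order_tendstoD) simp
  then obtain N where N: "\<And>i. i \<ge> N \<Longrightarrow> norm (q ^ i * w / (1 - q * q ^ i)) < 1 / 2"
    by (auto simp: eventually_at_top_linorder)
  show ?thesis
  proof (rule summable_ratio_test[of "1/2" N])
    fix i assume "i \<ge> N"
    have "euler_coeff q (Suc i) = - (q ^ i * euler_coeff q i) / (1 - q ^ Suc i)"
      using euler_coeff_Suc[OF assms, of i] one_minus_power_neq_0[OF assms(2), of i]
      by (metis nonzero_mult_div_cancel_right)
    hence "norm (euler_coeff q (Suc i) * w ^ Suc i) =
      norm (q ^ i * w / (1 - q * q ^ i)) * norm (euler_coeff q i * w ^ i)"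
      by (simp add: norm_mult norm_divide)
    also have "\<dots> \<le> 1 / 2 * norm (euler_coeff q i * w ^ i)"
      using N[OF \<open>i \<ge> N\<close>] by (intro mult_right_mono) auto
    finally show "norm (norm (euler_coeff q (Suc i) * w ^ Suc i)) \<le>
      1 / 2 * norm (norm (euler_coeff q i * w ^ i))" by simp
  qed simp
qed

lemma qpoch_inf_LIMSEQ:
  assumes "norm q < 1"
  shows "(\<lambda>n. \<Prod>j<n. 1 - a * q ^ j) \<longlonglongrightarrow> qpoch_inf a q"
  using convergent_prod_LIMSEQ[OF convergent_prod_qpoch[OF assms, of a]]
  unfolding qpoch_inf_def LIMSEQ_lessThan_iff_atMost .

text \<open>The series satisfies E(w) = (1 - w) E(qw). Iterating n times extracts the partial
  products and leaves E(w q^n), which tends to E(0) = 1 by continuity at 0.\<close>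

lemma qpoch_inf_euler:
  assumes "q \<noteq> 0" "norm q < 1"
  shows "qpoch_inf w q = (\<Sum>i. euler_coeff q i * w ^ i)"
proof -
  define E where "E = (\<lambda>w. \<Sum>i. euler_coeff q i * w ^ i)"
  have sm: "summable (\<lambda>i. euler_coeff q i * w ^ i)" for w
    by (rule summable_norm_cancel[OF summable_euler[OF assms]])
  have c0: "euler_coeff q 0 = 1"
    by (simp add: euler_coeff_def qpoch_def)
  have step: "E w = (1 - w) * E (q * w)" for w
  proof -
    have "E w - E (q * w) = (\<Sum>i. euler_coeff q i * (1 - q ^ i) * w ^ i)"
      unfolding E_def by (subst suminf_diff[OF sm sm]) (simp add: power_mult_distrib algebra_simps)
    \<comment> \<open>The term at i = 0 contains 1 - q^0 = 0, so the sum may start at 1, where the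
      recurrence applies.\<close>
    also have "\<dots> = (\<Sum>i. euler_coeff q (Suc i) * (1 - q ^ Suc i) * w ^ Suc i)"
    proof (subst suminf_split_head)
      have "summable (\<lambda>i. euler_coeff q i * w ^ i - euler_coeff q i * (q * w) ^ i)"
        by (intro summable_diff sm)
      thus "summable (\<lambda>i. euler_coeff q i * (1 - q ^ i) * w ^ i)"
        by (simp add: power_mult_distrib algebra_simps)
    qed simp
    also have "\<dots> = (\<Sum>i. (- w) * (euler_coeff q i * (q * w) ^ i))"
      unfolding euler_coeff_Suc[OF assms] by (simp add: power_mult_distrib algebra_simps)
    also have "\<dots> = - w * E (q * w)"
      unfolding E_def by (rule suminf_mult[OF sm])
    finally show ?thesis by (simp add: algebra_simps)
  qed
  have iter: "E w = (\<Prod>j<n. 1 - w * q ^ j) * E (w * q ^ n)" for n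
  proof (induction n)
    case (Suc n)
    thus ?case using step[of "w * q ^ n"] by (simp add: algebra_simps)
  qed simp
  have "isCont E 0"
    unfolding E_def by (rule isCont_powser_converges_everywhere[OF sm])
  moreover have "(\<lambda>n. w * q ^ n) \<longlonglongrightarrow> w * 0"
    using assms by (intro tendsto_intros LIMSEQ_power_zero) auto
  ultimately have "(\<lambda>n. E (w * q ^ n)) \<longlonglongrightarrow> E 0"
    by (intro isCont_tendsto_compose[of 0 E]) simp_all
  hence "(\<lambda>n. (\<Prod>j<n. 1 - w * q ^ j) * E (w * q ^ n)) \<longlonglongrightarrow> qpoch_inf w q * E 0"
    by (intro tendsto_intros qpoch_inf_LIMSEQ assms)
  hence "(\<lambda>n. E w) \<longlonglongrightarrow> qpoch_inf w q * E 0"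
    by (simp flip: iter)
  hence "E w = qpoch_inf w q * E 0"
    by (simp add: LIMSEQ_const_iff)
  moreover have "E 0 = 1"
    unfolding E_def by (simp add: c0)
  ultimately show ?thesis by (simp add: E_def)
qed

text \<open>A finite product of absolutely convergent series is a series over choice functions.
  These are then transported to vectors, the index type of \<open>H_series\<close>.\<close>

lemma prod_qpoch_inf_euler:
  fixes W :: "'r::finite \<Rightarrow> complex"
  assumes "q \<noteq> 0" "norm q < 1"
  shows "(\<Prod>s\<in>UNIV. qpoch_inf (W s) q) =
    (\<Sum>\<^sub>\<infinity>i\<in>UNIV. \<Prod>s\<in>UNIV. euler_coeff q (i $ s) * W s ^ (i $ s))"
proof -
  have abs: "(\<lambda>i. norm (euler_coeff q i * w ^ i)) summable_on UNIV" for w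
    using summable_euler[OF assms, of w] by (intro norm_summable_imp_summable_on) simp
  have "qpoch_inf w q = (\<Sum>\<^sub>\<infinity>i. euler_coeff q i * w ^ i)" for w
    unfolding qpoch_inf_euler[OF assms]
    by (rule infsumI[symmetric], rule norm_summable_imp_has_sum[OF summable_euler[OF assms]])
       (rule summable_sums[OF summable_norm_cancel[OF summable_euler[OF assms]]])
  hence "(\<Prod>s\<in>UNIV. qpoch_inf (W s) q) = (\<Prod>s\<in>UNIV. \<Sum>\<^sub>\<infinity>i. euler_coeff q i * W s ^ i)"
    by simp
  also have "\<dots> = (\<Sum>\<^sub>\<infinity>g\<in>PiE UNIV (\<lambda>_. UNIV). \<Prod>s\<in>UNIV. euler_coeff q (g s) * W s ^ g s)"
    by (rule infsum_prod_PiE_abs[symmetric]) (auto intro: abs)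
  also have "\<dots> = (\<Sum>\<^sub>\<infinity>i\<in>UNIV. \<Prod>s\<in>UNIV. euler_coeff q (i $ s) * W s ^ (i $ s))"
  proof -
    have "bij_betw vec_nth (UNIV :: (nat ^ 'r) set) UNIV"
      by (rule bij_betw_byWitness[of _ vec_lambda]) auto
    from infsum_reindex_bij_betw[OF this, of "\<lambda>g. \<Prod>s\<in>UNIV. euler_coeff q (g s) * W s ^ g s"]
    show ?thesis by (simp add: PiE_UNIV_domain)
  qed
  finally show ?thesis .
qed

section \<open>Absolute convergence of Gaussian series over the integers\<close>

lemma summable_gauss_int:
  fixes A B :: complex
  assumes "Re A < 0"
  shows "(\<lambda>n::int. norm (exp (A * of_int n ^ 2 + B * of_int n))) summable_on UNIV"
proof -
  define c where "c = - Re A"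
  have c: "c > 0" using assms by (simp add: c_def)
  \<comment> \<open>Chosen so that c t^2 - (|Re B| + 1) t + C is a perfect square divided by 4c; the
    extra 1 leaves the decay exp(-t).\<close>
  define C where "C = (\<bar>Re B\<bar> + 1) ^ 2 / (4 * c)"
  have bound: "norm (exp (A * of_int n ^ 2 + B * of_int n)) \<le> exp C * exp (- \<bar>of_int n\<bar>)" for n :: int
  proof -
    define t where "t = \<bar>real_of_int n\<bar>"
    have "Re (A * of_int n ^ 2 + B * of_int n) = - c * t ^ 2 + Re B * of_int n"
      by (simp add: c_def t_def power2_eq_square)
    also have "\<dots> \<le> - c * t ^ 2 + \<bar>Re B\<bar> * t"
      unfolding t_def by (simp add: abs_mult[symmetric])
    also have "\<dots> \<le> C - t"
    proof -
      have "0 \<le> (2 * c * t - (\<bar>Re B\<bar> + 1)) ^ 2" by simp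
      also have "\<dots> = 4 * c * (c * t ^ 2 - (\<bar>Re B\<bar> + 1) * t + C)"
        using c by (simp add: C_def power2_eq_square field_simps)
      finally have "0 \<le> c * t ^ 2 - (\<bar>Re B\<bar> + 1) * t + C"
        using c by (simp add: zero_le_mult_iff)
      thus ?thesis by (simp add: algebra_simps)
    qed
    finally show ?thesis
      by (simp add: t_def norm_exp_eq_Re exp_add[symmetric])
  qed
  have nat: "(\<lambda>n::nat. exp C * exp (- real n)) summable_on UNIV"
  proof (rule norm_summable_imp_summable_on)
    have "summable (\<lambda>n. exp C * exp (- 1 :: real) ^ n)"
      by (intro summable_mult summable_geometric) simp
    thus "summable (\<lambda>n. norm (exp C * exp (- real n)))"
      by (simp add: exp_of_nat_mult[symmetric])
  qed
  \<comment> \<open>Two geometric series cover the integers; their overlap at 0 is harmless for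
    summability.\<close>
  have "(\<lambda>n::int. exp C * exp (- \<bar>of_int n\<bar>)) summable_on (range int \<union> range (\<lambda>n. - int n))"
    using nat by (intro summable_on_union)
      (subst summable_on_reindex, auto simp: inj_on_def o_def)+
  moreover have "range int \<union> range (\<lambda>n. - int n) = UNIV"
  proof (intro equalityI subsetI)
    fix n :: int
    show "n \<in> range int \<union> range (\<lambda>n. - int n)" by (cases n rule: int_cases2) auto
  qed simp
  ultimately have "(\<lambda>n::int. exp C * exp (- \<bar>of_int n\<bar>)) summable_on UNIV" by simp
  thus ?thesis
    by (rule Infinite_Sum.abs_summable_on_comparison_test') (use bound in auto)
qed

section \<open>Roots of unity and their orthogonality\<close>

lemma zeta_power: "zeta a k ^ n = zeta a (int n * k)"
  by (simp add: zeta_def exp_of_nat_mult[symmetric] mult_ac)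

lemma zeta_add: "zeta a (k + l) = zeta a k * zeta a l"
  by (simp add: zeta_def exp_add[symmetric] add_divide_distrib algebra_simps)

lemma norm_zeta [simp]: "norm (zeta a k) = 1"
  by (simp add: zeta_def norm_exp_eq_Re)

lemma zeta_powi: "zeta a k powi n = zeta a (n * k)"
proof (cases n rule: int_cases2)
  case (nonpos m)
  have "zeta a (- (int m * k)) * zeta a (int m * k) = 1"
    by (simp flip: zeta_add) (simp add: zeta_def)
  thus ?thesis using nonpos
    by (simp add: power_int_minus zeta_power) (metis inverse_unique mult.commute)
qed (simp add: zeta_power)

lemma zeta_eq_1_iff:
  assumes "a > 0"
  shows "zeta a k = 1 \<longleftrightarrow> int a dvd k"
proof -
  have "zeta a k = 1 \<longleftrightarrow> (\<exists>n::int. 2 * pi * of_int k / of_nat a = of_int (2 * n) * pi)"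
    by (simp add: zeta_def exp_eq_1)
  also have "\<dots> \<longleftrightarrow> (\<exists>n::int. real_of_int k = real_of_int (int a * n))"
    using assms by (intro arg_cong[of _ _ Ex] ext) (auto simp: field_simps)
  also have "\<dots> \<longleftrightarrow> int a dvd k"
    unfolding of_int_eq_iff dvd_def ..
  finally show ?thesis .
qed

text \<open>A geometric sum whose ratio has a-th power 1: it vanishes unless the ratio itself is 1.
  This is the filter that selects a residue class mod a.\<close>

lemma sum_zeta:
  assumes "a > 0"
  shows "(\<Sum>u<a. zeta a (int u * k)) = (if int a dvd k then of_nat a else 0)"
proof (cases "int a dvd k")
  case True
  hence "zeta a (int u * k) = 1" for u
    using zeta_eq_1_iff[OF assms] by simp
  thus ?thesis using True by simp
next
  case False
  have "(\<Sum>u<a. zeta a (int u * k)) = (\<Sum>u<a. zeta a k ^ u)"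
    by (simp add: zeta_power)
  also have "\<dots> = (zeta a k ^ a - 1) / (zeta a k - 1)"
    using False zeta_eq_1_iff[OF assms] by (intro geometric_sum) simp
  also have "zeta a k ^ a = 1"
    using zeta_eq_1_iff[OF assms] by (simp add: zeta_power)
  finally show ?thesis using False by simp
qed


lemma zeta_sum: "finite S \<Longrightarrow> (\<Prod>s\<in>S. zeta a (f s)) = zeta a (\<Sum>s\<in>S. f s)"
  by (induction S rule: finite_induct) (simp_all add: zeta_add, simp add: zeta_def)

section \<open>Real powers of q and products of series\<close>

lemma qpow_add: "qpow lq (c + d) = qpow lq c * qpow lq d"
  by (simp add: qpow_def algebra_simps exp_add)

lemma qpow_sum: "finite S \<Longrightarrow> (\<Prod>s\<in>S. qpow lq (f s)) = qpow lq (\<Sum>s\<in>S. f s)"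
  by (induction S rule: finite_induct) (simp_all add: qpow_add, simp add: qpow_def)

lemma qpow_powi: "qpow lq c powi n = qpow lq (c * of_int n)"
  by (simp add: qpow_def exp_power_int mult_ac)

lemma qpow_power: "qpow lq c ^ n = qpow lq (c * of_nat n)"
  by (simp add: qpow_def exp_of_nat_mult[symmetric] mult_ac)

lemma prod_powi: "finite S \<Longrightarrow> z \<noteq> 0 \<Longrightarrow> (\<Prod>s\<in>S. z powi f s) = z powi (\<Sum>s\<in>S. f s)" for z :: complex
  by (induction S rule: finite_induct) (simp_all add: power_int_add)

lemma abs_summable_times:
  fixes f :: "'a \<Rightarrow> complex" and g :: "'b \<Rightarrow> complex"
  assumes "(\<lambda>x. norm (f x)) summable_on A" "(\<lambda>y. norm (g y)) summable_on B"
  shows "(\<lambda>p. norm (case p of (x, y) \<Rightarrow> f x * g y)) summable_on A \<times> B"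
  unfolding Infinite_Sum.abs_summable_on_Sigma_iff using assms
  by (auto simp: norm_mult infsum_cmult_right' abs_mult intro!: summable_on_cmult_right summable_on_cmult_left)

text \<open>The hypothesis is joint summability because the rows in \<open>theorem1p9\<close>
  inherit it from a larger summable family. Constants leave \<open>infsum\<close> unconditionally in
  a field.\<close>

lemma infsum_times:
  fixes f :: "'a \<Rightarrow> complex" and g :: "'b \<Rightarrow> complex"
  assumes "(\<lambda>(x, y). f x * g y) summable_on A \<times> B"
  shows "infsum (\<lambda>(x, y). f x * g y) (A \<times> B) = infsum f A * infsum g B"
  using infsum_Sigma_banach[OF assms] by (simp add: infsum_cmult_right' infsum_cmult_left')

lemma has_sum_finite_sum:
  fixes f :: "'a \<Rightarrow> 'b \<Rightarrow> complex"
  assumes "finite I" "\<And>i. i \<in> I \<Longrightarrow> (f i has_sum S i) A"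
  shows "((\<lambda>x. \<Sum>i\<in>I. f i x) has_sum (\<Sum>i\<in>I. S i)) A"
  using assms by (induction I rule: finite_induct) (auto intro: has_sum_add)

section \<open>Terms of H and of the theta series\<close>

definition index_diff :: "(nat ^ 'r::finite) \<times> (nat ^ 'r) \<Rightarrow> int" where
  "index_diff = (\<lambda>(i, j). \<Sum>s\<in>UNIV. int (i $ s) - int (j $ s))"

text \<open>The entries of x and y are scaled by opposite powers, so only the difference of their
  total degrees remains. The factor has modulus 1, hence twisting preserves absolute
  convergence.\<close>

lemma H_term_zeta:
  "H_term \<alpha> (zeta a m *s x) (zeta a (- m) *s y) q lq ij =
     zeta a (m * index_diff ij) * H_term \<alpha> x y q lq ij"
proof (cases ij)
  case (Pair i j)
  have "(\<Prod>s\<in>UNIV. (- (zeta a m * x $ s)) ^ (i $ s) * (- (zeta a (- m) * y $ s)) ^ (j $ s)) =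
    (\<Prod>s\<in>UNIV. zeta a (m * (int (i $ s) - int (j $ s))) * ((- (x $ s)) ^ (i $ s) * (- (y $ s)) ^ (j $ s)))"
  proof (rule prod.cong[OF refl])
    fix s
    have "(- (zeta a m * x $ s)) ^ (i $ s) * (- (zeta a (- m) * y $ s)) ^ (j $ s) =
      (zeta a m ^ (i $ s) * zeta a (- m) ^ (j $ s)) * ((- (x $ s)) ^ (i $ s) * (- (y $ s)) ^ (j $ s))"
    proof -
      have "- (zeta a m * x $ s) = zeta a m * - (x $ s)" "- (zeta a (- m) * y $ s) = zeta a (- m) * - (y $ s)"
        by simp_all
      thus ?thesis by (simp only: power_mult_distrib mult_ac)
    qed
    also have "zeta a m ^ (i $ s) * zeta a (- m) ^ (j $ s) = zeta a (m * (int (i $ s) - int (j $ s)))"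
      unfolding zeta_power zeta_add[symmetric] by (simp add: algebra_simps)
    finally show "(- (zeta a m * x $ s)) ^ (i $ s) * (- (zeta a (- m) * y $ s)) ^ (j $ s) =
      zeta a (m * (int (i $ s) - int (j $ s))) * ((- (x $ s)) ^ (i $ s) * (- (y $ s)) ^ (j $ s))" .
  qed
  also have "\<dots> = zeta a (m * index_diff ij) * (\<Prod>s\<in>UNIV. (- (x $ s)) ^ (i $ s) * (- (y $ s)) ^ (j $ s))"
    by (simp add: prod.distrib zeta_sum index_diff_def Pair sum_distrib_left)
  finally show ?thesis by (simp add: H_term_def Pair)
qed

text \<open>The N-th term of the theta series in the theorem at u = 0: the exponent of q adds
  N(1-a)/(2ab) from the argument and N(N-1)/(2ab) from the nome.\<close>

definition theta_term :: "complex \<Rightarrow> complex \<Rightarrow> nat \<Rightarrow> nat \<Rightarrow> int \<Rightarrow> complex" where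
  "theta_term z lq a b N = z powi N *
     qpow lq (of_int N ^ 2 / (2 * real a * real b) - of_int N / (2 * real b))"

text \<open>The sign in the argument cancels the one in \<open>qtheta\<close>, and u enters only
  through a root of unity raised to the power N.\<close>

lemma qtheta_eq_infsum:
  assumes "a > 0" "b > 0"
  shows "qtheta (- zeta a (- u) * z * qpow lq ((1 - real a) / (2 * real a * real b)))
      (qpow lq (1 / (real a * real b))) = (\<Sum>\<^sub>\<infinity>N. zeta a (- u * N) * theta_term z lq a b N)"
  unfolding qtheta_def
proof (rule infsum_cong)
  fix N :: int
  have e: "(1 - real a) / (2 * real a * real b) * of_int N +
      1 / (real a * real b) * of_int (N * (N - 1) div 2) =
      of_int N ^ 2 / (2 * real a * real b) - of_int N / (2 * real b)"
    unfolding real_triangular_int using assms by (simp add: field_simps power2_eq_square)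
  show "(- (- zeta a (- u) * z * qpow lq ((1 - real a) / (2 * real a * real b)))) powi N *
      qpow lq (1 / (real a * real b)) powi (N * (N - 1) div 2) =
      zeta a (- u * N) * theta_term z lq a b N"
    unfolding theta_term_def e[symmetric] qpow_add qpow_powi
    by (simp add: power_int_mult_distrib zeta_powi qpow_powi mult_ac)
qed

text \<open>Writing z as an exponential makes the term Gaussian in N with leading coefficient
  \<open>lq\<close>/(2ab), whose real part is negative because |q| < 1.\<close>

lemma theta_term_abs_summable:
  assumes "a > 0" "b > 0" "z \<noteq> 0" "norm (exp lq) < 1"
  shows "(\<lambda>N. norm (theta_term z lq a b N)) summable_on UNIV"
proof -
  have "Re (lq / of_real (2 * real a * real b)) < 0"
    using assms by (simp add: Re_divide_of_real divide_neg_pos del: of_real_mult)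
  moreover have "theta_term z lq a b N = exp (lq / of_real (2 * real a * real b) * of_int N ^ 2 +
      (ln z - lq / of_real (2 * real b)) * of_int N)" for N
  proof -
    have "z powi N = exp (of_int N * ln z)"
      using assms by (metis exp_Ln exp_power_int)
    thus ?thesis
      by (simp add: theta_term_def qpow_def exp_add[symmetric] algebra_simps)
  qed
  ultimately show ?thesis
    using summable_gauss_int by presburger
qed

section \<open>A single term of the bilateral series as a sum of products of H and theta
  terms\<close>

text \<open>Each of the r reflections contributes q^(n(n-1)/2), which together turn the exponent
  factor \<open>\<alpha>\<close> - r into \<open>\<alpha>\<close>. The multiplied products clear the
  denominators left by \<open>inverse_qpoch\<close>.\<close>

lemma L_term_eq_qpoch_inf:
  fixes x y :: "complex ^ 'r"
  assumes "exp lq = q" "norm q < 1" and "\<And>s. y $ s \<noteq> 0"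
    and nz: "\<And>s. qpoch_inf (x $ s) q \<noteq> 0" "\<And>s. qpoch_inf (q * y $ s) q \<noteq> 0"
  shows "L_term \<alpha> x y q lq w n * (\<Prod>s\<in>UNIV. qpoch_inf (x $ s) q * qpoch_inf (q * y $ s) q) =
    w powi n * qpow lq (\<alpha> * of_int (n * (n - 1) div 2)) *
      ((\<Prod>s\<in>UNIV. qpoch_inf (x $ s * q powi n) q) *
       (\<Prod>s\<in>UNIV. qpoch_inf (q * y $ s * q powi (- n)) q))"
proof -
  define t where "t = n * (n - 1) div 2"
  have q: "q \<noteq> 0" using assms(1) by auto
  have qp: "q = qpow lq 1" using assms(1) by (simp add: qpow_def)
  have "qpoch (1 / y $ s) q n * (- (y $ s)) powi n / qpoch (x $ s) q n *
      (qpoch_inf (x $ s) q * qpoch_inf (q * y $ s) q) =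
      qpow lq (of_int t) * (qpoch_inf (x $ s * q powi n) q * qpoch_inf (q * y $ s * q powi (- n)) q)" for s
  proof -
    have "q powi t = qpow lq (of_int t)" by (subst qp) (simp add: qpow_powi)
    thus ?thesis
      unfolding qpoch_reflect[OF q assms(3)]
      unfolding divide_inverse inverse_qpoch[OF q assms(2) nz(1)]
        inverse_qpoch[OF q assms(2) nz(2)] t_def[symmetric]
      using nz[of s] by (simp add: field_simps)
  qed
  hence "(\<Prod>s\<in>UNIV. qpoch (1 / y $ s) q n * (- (y $ s)) powi n / qpoch (x $ s) q n) *
      (\<Prod>s\<in>UNIV. qpoch_inf (x $ s) q * qpoch_inf (q * y $ s) q) =
      qpow lq (real CARD('r) * of_int t) * ((\<Prod>s\<in>UNIV. qpoch_inf (x $ s * q powi n) q) *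
       (\<Prod>s\<in>UNIV. qpoch_inf (q * y $ s * q powi (- n)) q))"
    by (simp add: prod.distrib[symmetric]) (simp add: prod.distrib qpow_power mult_ac)
  hence "L_term \<alpha> x y q lq w n * (\<Prod>s\<in>UNIV. qpoch_inf (x $ s) q * qpoch_inf (q * y $ s) q) =
    w powi n * qpow lq ((\<alpha> - real CARD('r)) * of_int t) *
      (qpow lq (real CARD('r) * of_int t) * ((\<Prod>s\<in>UNIV. qpoch_inf (x $ s * q powi n) q) *
       (\<Prod>s\<in>UNIV. qpoch_inf (q * y $ s * q powi (- n)) q)))"
    unfolding L_term_def t_def by (simp only: mult.assoc)
  moreover have "qpow lq (\<alpha> * of_int t) =
      qpow lq ((\<alpha> - real CARD('r)) * of_int t) * qpow lq (real CARD('r) * of_int t)"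
    by (simp add: qpow_add[symmetric] algebra_simps)
  ultimately show ?thesis
    unfolding t_def[symmetric] by (simp only: mult.assoc)
qed

lemma euler_coeff_qpow:
  assumes "exp lq = q"
  shows "euler_coeff q i = (- 1) ^ i * qpow lq ((real i ^ 2 - real i) / 2) / qpoch q q (int i)"
proof -
  have qp: "q = qpow lq 1" using assms by (simp add: qpow_def)
  have "q powi (int i * (int i - 1) div 2) = qpow lq ((real i ^ 2 - real i) / 2)"
    by (subst qp, subst qpow_powi, subst real_triangular_int) simp
  thus ?thesis by (simp add: euler_coeff_def)
qed

text \<open>The exponent of \<open>q\<close> is \<open>Q\<^sub>\<alpha>/2 + \<alpha>/2 (m\<^sup>2 - m)\<close> with \<open>\<alpha> = a/b\<close> and
  \<open>m = n + k/\<alpha> = N/a\<close>.\<close>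

lemma euler_terms_eq_H_theta:
  fixes x y :: "complex ^ 'r"
  assumes "exp lq = q" "a > 0" "b > 0" "z \<noteq> 0"
  shows "(z ^ a) powi n * qpow lq (real a / real b * of_int (n * (n - 1) div 2)) *
      ((\<Prod>s\<in>UNIV. euler_coeff q (i $ s) * (z ^ b * x $ s * q powi n) ^ (i $ s)) *
       (\<Prod>s\<in>UNIV. euler_coeff q (j $ s) * (q * z powi (- int b) * y $ s * q powi (- n)) ^ (j $ s))) =
    H_term (real a / real b) x y q lq (i, j) *
      theta_term z lq a b (int a * n + int b * index_diff (i, j))"
proof -
  have qp: "q = qpow lq 1" using assms by (simp add: qpow_def)
  have q: "q powi m = qpow lq (of_int m)" for m by (subst qp) (simp add: qpow_powi)
  have X: "euler_coeff q (i $ s) * (z ^ b * x $ s * q powi n) ^ (i $ s) =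
     qpow lq ((real (i $ s) ^ 2 - real (i $ s)) / 2 + of_int n * real (i $ s)) *
     z powi (int b * int (i $ s)) * ((- (x $ s)) ^ (i $ s) / qpoch q q (int (i $ s)))" for s
  proof -
    have "(z ^ b * x $ s * q powi n) ^ (i $ s) =
      z powi (int b * int (i $ s)) * x $ s ^ (i $ s) * qpow lq (of_int n * real (i $ s))"
      by (simp add: power_mult_distrib q qpow_power power_int_mult)
    moreover have "(- (x $ s)) ^ (i $ s) = (- 1) ^ (i $ s) * x $ s ^ (i $ s)"
      by (rule power_minus)
    ultimately show ?thesis
      by (simp add: euler_coeff_qpow[OF assms(1)] qpow_add)
  qed
  \<comment> \<open>The additional q in front of y is the source of 1 - n here, in contrast to n in
    \<open>X\<close>.\<close>
  have Y: "euler_coeff q (j $ s) * (q * z powi (- int b) * y $ s * q powi (- n)) ^ (j $ s) =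
     qpow lq ((real (j $ s) ^ 2 - real (j $ s)) / 2 + (1 - of_int n) * real (j $ s)) *
     z powi (- int b * int (j $ s)) * ((- (y $ s)) ^ (j $ s) / qpoch q q (int (j $ s)))" for s
  proof -
    have "q * z powi (- int b) * y $ s * q powi (- n) = z powi (- int b) * y $ s * qpow lq (1 - of_int n)"
      by (simp add: q qpow_add[of _ 1 "- of_int n", simplified] flip: qp)
    hence "(q * z powi (- int b) * y $ s * q powi (- n)) ^ (j $ s) =
      z powi (- int b * int (j $ s)) * y $ s ^ (j $ s) * qpow lq ((1 - of_int n) * real (j $ s))"
      by (simp only: power_mult_distrib qpow_power power_int_mult power_int_of_nat)
    moreover have "(- (y $ s)) ^ (j $ s) = (- 1) ^ (j $ s) * y $ s ^ (j $ s)"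
      by (rule power_minus)
    ultimately show ?thesis
      by (simp add: euler_coeff_qpow[OF assms(1)] qpow_add)
  qed
  have za: "(z ^ a) powi n = z powi (int a * n)" by (simp add: power_int_mult)
  define I where "I = (\<Sum>s\<in>UNIV. real (i $ s))"
  define J where "J = (\<Sum>s\<in>UNIV. real (j $ s))"
  define I2 where "I2 = (\<Sum>s\<in>UNIV. real (i $ s) ^ 2)"
  define J2 where "J2 = (\<Sum>s\<in>UNIV. real (j $ s) ^ 2)"
  define M where "M = (\<Prod>s\<in>UNIV. (- (x $ s)) ^ (i $ s) * (- (y $ s)) ^ (j $ s)) /
     (\<Prod>s\<in>UNIV. qpoch q q (int (i $ s)) * qpoch q q (int (j $ s)))"
  define N where "N = int a * n + int b * index_diff (i, j)"
  have N: "real_of_int N = real a * of_int n + real b * (I - J)"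
    by (simp add: N_def index_diff_def I_def J_def sum_subtractf)
  have eX: "(\<Sum>s\<in>UNIV. (real (i $ s) ^ 2 - real (i $ s)) / 2 + of_int n * real (i $ s)) =
      (I2 - I) / 2 + of_int n * I"
    unfolding I_def I2_def
    by (simp add: sum.distrib sum_subtractf sum_divide_distrib[symmetric] sum_distrib_left)
  have eY: "(\<Sum>s\<in>UNIV. (real (j $ s) ^ 2 - real (j $ s)) / 2 + (1 - of_int n) * real (j $ s)) =
      (J2 - J) / 2 + (1 - of_int n) * J"
    unfolding J_def J2_def
    by (simp add: sum.distrib sum_subtractf sum_divide_distrib[symmetric] sum_distrib_left)
  have zN: "z powi (int a * n) * (z powi (\<Sum>s\<in>UNIV. int b * int (i $ s)) *
      z powi (\<Sum>s\<in>UNIV. - int b * int (j $ s))) = z powi N"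
    unfolding N_def index_diff_def using assms(4)
    by (simp add: power_int_add[symmetric] sum_subtractf sum_distrib_left sum_negf algebra_simps)
  have Q: "Q_form (real a / real b) i j = I2 + J2 - real b / real a * (I - J) ^ 2"
    by (simp add: Q_form_def I_def J_def I2_def J2_def sum.distrib sum_subtractf)
  \<comment> \<open>The linear terms in I and J combine to (n - 1/2)(I - J), so completing the
    square involves only k = I - J; it leaves -k^2/(2 \<open>\<alpha>\<close>), the correction
    inside \<open>Q_form\<close>/2.\<close>
  have expo: "real a / real b * of_int (n * (n - 1) div 2) + (((I2 - I) / 2 + of_int n * I) +
      ((J2 - J) / 2 + (1 - of_int n) * J)) =
      Q_form (real a / real b) i j / 2 +
      (of_int N ^ 2 / (2 * real a * real b) - of_int N / (2 * real b))"
    unfolding Q N real_triangular_int using assms(2,3)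
    by (simp add: field_simps power2_eq_square)
  have "(z ^ a) powi n * qpow lq (real a / real b * of_int (n * (n - 1) div 2)) *
      ((\<Prod>s\<in>UNIV. euler_coeff q (i $ s) * (z ^ b * x $ s * q powi n) ^ (i $ s)) *
       (\<Prod>s\<in>UNIV. euler_coeff q (j $ s) * (q * z powi (- int b) * y $ s * q powi (- n)) ^ (j $ s))) =
     (z powi (int a * n) * (z powi (\<Sum>s\<in>UNIV. int b * int (i $ s)) *
      z powi (\<Sum>s\<in>UNIV. - int b * int (j $ s)))) *
     (qpow lq (real a / real b * of_int (n * (n - 1) div 2)) * (qpow lq ((I2 - I) / 2 + of_int n * I) *
      qpow lq ((J2 - J) / 2 + (1 - of_int n) * J))) * M"
    unfolding X Y prod.distrib prod_dividef qpow_sum[OF finite] prod_powi[OF finite assms(4)] eX eY M_def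
    by (simp add: za mult_ac)
  also have "\<dots> = qpow lq (Q_form (real a / real b) i j / 2) * M * theta_term z lq a b N"
    unfolding zN qpow_add[symmetric] expo theta_term_def
    by (simp add: qpow_add mult_ac)
  finally show ?thesis
    by (simp add: H_term_def M_def N_def)
qed

section \<open>Averaging over roots of unity and summation by rows\<close>

theorem theorem1p9:
  fixes q lq z :: complex and a b :: nat and x y :: "complex ^ 'r"
  assumes "0 < norm q" and "norm q < 1" and "exp lq = q"
    and "0 < a" and "0 < b" and "coprime a b" and "b * CARD('r) \<le> a"
    and "z \<noteq> 0" and "\<And>s. x $ s \<noteq> 0" and "\<And>s. y $ s \<noteq> 0"
    and "\<And>s. qpoch_inf (z ^ b * x $ s) q \<noteq> 0"
    and "\<And>s. qpoch_inf (q * z powi (- int b) * y $ s) q \<noteq> 0"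
    and "\<And>u. u < a \<Longrightarrow>
      (\<lambda>ij. norm (H_term (real a / real b) (zeta a (int u) *s x) (zeta a (- int u) *s y) q lq ij))
        summable_on UNIV"
  shows "L_term (real a / real b) (z ^ b *s x) (z powi (- int b) *s y) q lq (z ^ a)
           summable_on UNIV
    \<and> L_series (real a / real b) (z ^ b *s x) (z powi (- int b) *s y) q lq (z ^ a) =
      1 / of_nat a * (\<Sum>u<a.
        H_series (real a / real b) (zeta a (int (b * u)) *s x) (zeta a (- int (b * u)) *s y) q lq /
        (\<Prod>s\<in>UNIV. qpoch_inf (z ^ b * x $ s) q * qpoch_inf (q * z powi (- int b) * y $ s) q) *
        qtheta (- zeta a (- int u) * z * qpow lq ((1 - real a) / (2 * real a * real b)))
          (qpow lq (1 / (real a * real b))))"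
proof -
  define h where "h = H_term (real a / real b) x y q lq"
  define T where "T = theta_term z lq a b"
  define k where "k = (index_diff :: (nat ^ 'r) \<times> (nat ^ 'r) \<Rightarrow> int)"
  define D where "D = (\<Prod>s\<in>UNIV. qpoch_inf (z ^ b * x $ s) q * qpoch_inf (q * z powi (- int b) * y $ s) q)"
  define L where "L = L_term (real a / real b) (z ^ b *s x) (z powi (- int b) *s y) q lq (z ^ a)"
  have q: "q \<noteq> 0" using assms(1) by auto
  have D: "D \<noteq> 0" using assms(11,12) by (simp add: D_def)
  \<comment> \<open>At u = 0 the twist is a factor of modulus 1, so the assumed convergence passes
    to \<open>h\<close>.\<close>
  have h_abs: "(\<lambda>ij. norm (h ij)) summable_on UNIV"
    using assms(13)[of 0] assms(4) H_term_zeta[of _ a 0 x y q lq]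
    by (simp add: h_def norm_mult)
  have T_abs: "(\<lambda>N. norm (T N)) summable_on UNIV"
    unfolding T_def using assms by (intro theta_term_abs_summable) auto

  let ?c = "\<lambda>(ij, N). if int a dvd int b * k ij - N then h ij * T N else 0"
  let ?H = "\<lambda>u. H_series (real a / real b) (zeta a (int (b * u)) *s x) (zeta a (- int (b * u)) *s y) q lq"
  let ?\<theta> = "\<lambda>u. qtheta (- zeta a (- int u) * z * qpow lq ((1 - real a) / (2 * real a * real b)))
          (qpow lq (1 / (real a * real b)))"
  \<comment> \<open>The twist of H by b u and that of theta by -u multiply to the root of unity with
    exponent u (b k - N); averaging over u keeps exactly the pairs with N = b k mod a.\<close>
  have avg: "(?c has_sum (1 / of_nat a * (\<Sum>u<a. ?H u * ?\<theta> u))) (UNIV \<times> UNIV)"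
  proof -
    let ?f = "\<lambda>u ij. zeta a (int (b * u) * k ij) * h ij"
    let ?g = "\<lambda>u N. zeta a (- int u * N) * T N"
    have H: "?H u = infsum (?f u) UNIV" for u
      unfolding H_series_def H_term_zeta h_def k_def ..
    have Th: "?\<theta> u = infsum (?g u) UNIV" for u
      unfolding qtheta_eq_infsum[OF assms(4,5)] T_def ..
    have hs: "((\<lambda>(ij, N). ?f u ij * ?g u N) has_sum infsum (?f u) UNIV * infsum (?g u) UNIV) (UNIV \<times> UNIV)" for u
    proof -
      have "(\<lambda>p. norm (case p of (ij, N) \<Rightarrow> ?f u ij * ?g u N)) summable_on UNIV \<times> UNIV"
        using h_abs T_abs by (intro abs_summable_times) (simp_all add: norm_mult)
      hence s: "(\<lambda>(ij, N). ?f u ij * ?g u N) summable_on UNIV \<times> UNIV"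
        by (rule abs_summable_summable)
      from has_sum_infsum[OF s] show ?thesis
        unfolding infsum_times[OF s] .
    qed
    have "((\<lambda>p. 1 / of_nat a * (\<Sum>u<a. (\<lambda>(ij, N). ?f u ij * ?g u N) p)) has_sum
      1 / of_nat a * (\<Sum>u<a. infsum (?f u) UNIV * infsum (?g u) UNIV)) (UNIV \<times> UNIV)"
      by (intro has_sum_cmult_right has_sum_finite_sum hs finite_lessThan)
    moreover have "1 / of_nat a * (\<Sum>u<a. (\<lambda>(ij, N). ?f u ij * ?g u N) p) = ?c p" for p
    proof (cases p)
      case (Pair ij N)
      have "(\<Sum>u<a. ?f u ij * ?g u N) = (\<Sum>u<a. zeta a (int u * (int b * k ij - N))) * (h ij * T N)"
        unfolding sum_distrib_right
      proof (rule sum.cong[OF refl])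
        fix u
        have "zeta a (int u * (int b * k ij - N)) = zeta a (int (b * u) * k ij) * zeta a (- int u * N)"
          unfolding zeta_add[symmetric] by (simp add: algebra_simps)
        thus "?f u ij * ?g u N = zeta a (int u * (int b * k ij - N)) * (h ij * T N)"
          by simp
      qed
      thus ?thesis using assms(4) by (simp add: Pair sum_zeta)
    qed
    ultimately show ?thesis
      unfolding H Th by simp
  qed

  let ?d = "\<lambda>(n, ij). h ij * T (int a * n + int b * k ij)"
  let ?\<phi> = "\<lambda>(n, ij). (ij, int a * n + int b * k ij)"
  let ?S = "{(ij, N). int a dvd int b * k ij - N}"
  \<comment> \<open>The surviving pairs are parametrised by n through N = a n + b k, uniquely since
    a > 0.\<close>
  have bij: "bij_betw ?\<phi> (UNIV \<times> UNIV) ?S"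
  proof (rule bij_betw_imageI)
    show "inj_on ?\<phi> (UNIV \<times> UNIV)" using assms(4) by (auto simp: inj_on_def)
    show "?\<phi> ` (UNIV \<times> UNIV) = ?S"
    proof (intro equalityI subsetI)
      fix p assume "p \<in> ?S"
      then obtain ij N m where p: "p = (ij, N)" "int b * k ij - N = int a * m"
        by (cases p) (auto elim!: dvdE)
      \<comment> \<open>The sign arises because m was taken from b k - N, whereas n measures N - b
        k.\<close>
      hence "p = ?\<phi> (- m, ij)" by (simp add: algebra_simps)
      thus "p \<in> ?\<phi> ` (UNIV \<times> UNIV)" by blast
    qed auto
  qed
  have "(?d has_sum R) (UNIV \<times> UNIV)" if "(?c has_sum R) (UNIV \<times> UNIV)" for R
  proof -
    \<comment> \<open>\<open>?c\<close> is 0 outside \<open>?S\<close>, so its sum over all pairs is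
      the sum over \<open>?S\<close>.\<close>
    have "((\<lambda>(ij, N). h ij * T N) has_sum R) ?S"
      using that by (subst has_sum_cong_neutral[of "UNIV \<times> UNIV" _ ?c]) auto
    thus ?thesis
      using has_sum_reindex_bij_betw[OF bij, of "\<lambda>(ij, N). h ij * T N" R]
      by (simp add: case_prod_unfold)
  qed
  note d = this[OF avg]

  \<comment> \<open>For fixed n the sum over (i, j) undoes Euler's expansion and restores the
    cleared n-th term of the bilateral series.\<close>
  have row: "(\<Sum>\<^sub>\<infinity>ij. ?d (n, ij)) = L n * D" for n
  proof -
    let ?X = "\<lambda>i. \<Prod>s\<in>UNIV. euler_coeff q (i $ s) * (z ^ b * x $ s * q powi n) ^ (i $ s)"
    let ?Y = "\<lambda>j. \<Prod>s\<in>UNIV. euler_coeff q (j $ s) * (q * z powi (- int b) * y $ s * q powi (- n)) ^ (j $ s)"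
    let ?C = "(z ^ a) powi n * qpow lq (real a / real b * of_int (n * (n - 1) div 2))"
    have eq: "?C * (?X i * ?Y j) = ?d (n, (i, j))" for i j
      using euler_terms_eq_H_theta[OF assms(3,4,5,8)] by (simp add: h_def T_def k_def)
    \<comment> \<open>Nonvanishing permits dividing by \<open>?C\<close>, so that summability of a
      row of \<open>?d\<close> yields that of the Euler double series.\<close>
    have C: "?C \<noteq> 0" using assms(8) by (simp add: qpow_def)
    have "?d summable_on (UNIV \<times> UNIV)" using d by (rule has_sum_imp_summable)
    hence "(\<lambda>ij. ?d (n, ij)) summable_on UNIV"
      using summable_on_SigmaD1[of "\<lambda>n ij. h ij * T (int a * n + int b * k ij)" UNIV "\<lambda>_. UNIV" n]
      by simp
    hence "(\<lambda>ij. ?C * (\<lambda>(i, j). ?X i * ?Y j) ij) summable_on UNIV"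
      by (rule summable_on_cong[THEN iffD1, rotated]) (use eq in auto)
    hence sXY: "(\<lambda>(i, j). ?X i * ?Y j) summable_on (UNIV \<times> UNIV)"
      using C by (subst (asm) summable_on_cmult_right') auto
    have "(\<Sum>\<^sub>\<infinity>ij. ?d (n, ij)) = (\<Sum>\<^sub>\<infinity>ij. ?C * (\<lambda>(i, j). ?X i * ?Y j) ij)"
      by (rule infsum_cong) (use eq in auto)
    also have "\<dots> = ?C * (infsum ?X UNIV * infsum ?Y UNIV)"
      using infsum_times[OF sXY] by (subst infsum_cmult_right') simp
    also have "\<dots> = L n * D"
      unfolding L_def D_def
      using L_term_eq_qpoch_inf[OF assms(3,2), of "z powi (- int b) *s y" "z ^ b *s x" "real a / real b" "z ^ a" n]
        assms(8,10,11,12)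
      by (simp add: prod_qpoch_inf_euler[OF q assms(2), symmetric] mult.assoc)
    finally show ?thesis .
  qed
  \<comment> \<open>Fubini for the summable family \<open>?d\<close>: it gives convergence of the
    bilateral series along with its value.\<close>
  have sum_rows: "((\<lambda>n. L n * D) has_sum R) UNIV" if R: "(?d has_sum R) (UNIV \<times> UNIV)" for R
  proof -
    have s: "?d summable_on (UNIV \<times> UNIV)" using R by (rule has_sum_imp_summable)
    have "(\<lambda>n. \<Sum>\<^sub>\<infinity>ij. ?d (n, ij)) summable_on UNIV"
      using summable_on_Sigma_banach[of "\<lambda>n ij. ?d (n, ij)" UNIV "\<lambda>_. UNIV"] s by (simp add: case_prod_unfold)
    moreover have "(\<Sum>\<^sub>\<infinity>n. \<Sum>\<^sub>\<infinity>ij. ?d (n, ij)) = R"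
      using infsum_Sigma_banach[OF s] infsumI[OF R] by simp
    ultimately show ?thesis unfolding row
      using has_sum_infsum by fastforce
  qed
  have "(\<lambda>n. L n * D * inverse D) = L" using D by (simp add: fun_eq_iff)
  hence "(L has_sum (1 / of_nat a * (\<Sum>u<a. ?H u * ?\<theta> u)) * inverse D) UNIV"
    using has_sum_cmult_left[OF sum_rows[OF d], of "inverse D"] by simp
  moreover have "1 / of_nat a * (\<Sum>u<a. F u * G u) * inverse D =
      1 / of_nat a * (\<Sum>u<a. F u / D * G u)" for F G :: "nat \<Rightarrow> complex"
    by (simp add: divide_inverse sum_distrib_left sum_distrib_right mult_ac)
  ultimately have "(L has_sum (1 / of_nat a * (\<Sum>u<a. ?H u / D * ?\<theta> u))) UNIV"
    by (simp only:)
  thus ?thesis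
    unfolding L_series_def L_def[symmetric] D_def[symmetric]
    using has_sum_imp_summable infsumI by blast
qed

end
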